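(* Let $v$, $k$ and $\lambda$ be positive integers such that $3 \leq k < v$, let $r$ and $d$ be the integers such that $\lambda(v-1)=r(k-1)-d$ and $0 \leq d < k-1$, let $n=r-\lambda$, and suppose that $r<k$. If $d < n$, then (a) $C_\lambda(v,k) \geq \left\lceil CB_{(v,k,\lambda)}\left(1-\frac{d^2}{2n(n+1)},\frac{n+2}{2(d+k)}\right)\right\rceil$; (b) $C_\lambda(v,k) \geq \left\lceil CB_{(v,k,\lambda)}\left(1,1-\frac{d(d+k-1)}{n(n+1)}\right)\right\rceil$ if $d \geq \frac{n}{2}$ and $d(d+k-1) < n(n+1)$; and (c) $C_\lambda(v,k) \geq \left\lceil CB_{(v,k,\lambda)}\left(1,\sqrt{\frac{d(n+2)}{(n+1)(n-d)}}-\frac{d(d+k)}{2(n+1)(n-d)}\right)\right\rceil$ if $d < \frac{n}{2}$ and $4(n+1)(n+2)(n-d) > d(d+k)^2$.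
   Context: A $(v,k,\lambda)$-covering is a pair $(V,\mathcal{B})$ where $V$ is a set of $v$ points and $\mathcal{B}$ is a collection of $k$-subsets of $V$ (blocks) such that every pair of distinct points lies together in at least $\lambda$ blocks; $C_\lambda(v,k)$ is the minimum number of blocks in a $(v,k,\lambda)$-covering. For positive integers $v,k,\lambda$ with $3\le k<v$ and nonnegative reals $\alpha\ge\beta$, define $$CB_{(v,k,\lambda)}(\alpha,\beta)=\frac{rv(\alpha-\beta)+\alpha v}{k(\alpha-\beta)+1},\qquad r=\left\lceil\frac{\lambda(v-1)}{k-1}\right\rceil.$$ *)

theory Defs
  imports Complex_Main "HOL-Library.Multiset"
begin

text \<open>A \<open>(v, k, \<lambda>)\<close>-covering. The blocks form a multiset: repeated blocks are allowed and are
  counted with multiplicity.\<close>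

definition covering :: "nat \<Rightarrow> nat \<Rightarrow> nat \<Rightarrow> 'a set \<Rightarrow> 'a set multiset \<Rightarrow> bool" where
  "covering v k lam V \<B> \<longleftrightarrow>
     finite V \<and> card V = v \<and>
     (\<forall>B \<in># \<B>. B \<subseteq> V \<and> card B = k) \<and>
     (\<forall>x \<in> V. \<forall>y \<in> V. x \<noteq> y \<longrightarrow> size {#B \<in># \<B>. x \<in> B \<and> y \<in> B#} \<ge> lam)"

text \<open>\<open>C\<^sub>\<lambda>(v, k)\<close>. Points are taken to be natural numbers; this is no restriction, since
  coverings are finite and can be relabelled. For \<open>2 \<le> k \<le> v\<close> a covering exists
  (\<open>\<lambda>\<close> copies of every \<open>k\<close>-subset), so the minimum is attained.\<close>

definition covering_number :: "nat \<Rightarrow> nat \<Rightarrow> nat \<Rightarrow> nat" where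
  "covering_number lam v k =
     (LEAST b. \<exists>(V :: nat set) \<B>. covering v k lam V \<B> \<and> size \<B> = b)"

text \<open>The expression \<open>CB\<^bsub>(v,k,\<lambda>)\<^esub>(\<alpha>, \<beta>)\<close>, intended for \<open>3 \<le> k < v\<close> and
  \<open>\<alpha> \<ge> \<beta> \<ge> 0\<close>, where the denominator is positive.\<close>

definition CB :: "nat \<Rightarrow> nat \<Rightarrow> nat \<Rightarrow> real \<Rightarrow> real \<Rightarrow> real" where
  "CB v k lam \<alpha> \<beta> =
     (let r = \<lceil>real lam * (real v - 1) / (real k - 1)\<rceil>
      in (real_of_int r * real v * (\<alpha> - \<beta>) + \<alpha> * real v) / (real k * (\<alpha> - \<beta>) + 1))"

end

theory Submission
  imports Defs
begin

text \<open>Let \<open>w(x, y) \<ge> 0\<close> be the excess of a pair, \<open>V0\<close> and \<open>V1\<close> the points on \<open>r\<close> and \<open>r + 1\<close>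
  blocks; their excess degrees are \<open>d\<close> and \<open>d + k - 1\<close>. As in Bose's proof of Fisher's inequality,
  a set \<open>S\<close> of points has at most as many elements as there are blocks if the Gram matrix of
  its incidence vectors is positive definite. That matrix is \<open>\<lambda>J + diag + w\<close> with
  diagonal entries \<open>n\<close> on \<open>V0\<close> and \<open>n + 1\<close> on \<open>V1\<close>. Since \<open>d < n\<close>, rescaling the rows of \<open>V0\<close> makes
  an edge from \<open>V1\<close> to \<open>V0\<close> count only \<open>q = d / n\<close>, so \<open>S = V0 \<union> T\<close> works for every \<open>T \<subseteq> V1\<close> in which
  all weighted degrees are below \<open>n + 1\<close>. Such a \<open>T\<close> is obtained from \<open>V1\<close> by repeatedly deleting
  a point of maximum weighted degree; a convex potential of Caro--Tuza type bounds \<open>|T|\<close> from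
  below. In (a) the cost of the edges between \<open>V0\<close> and \<open>V1\<close> is charged to \<open>V0\<close>, in (b) and (c)
  to \<open>V1\<close>, where the potential is then minimised over the unknown share of edges going to \<open>V0\<close>.\<close>

section \<open>Linear algebra over the reals\<close>

text \<open>Gaussian elimination by induction on the number of equations: a pivot \<open>p\<close>
  of the first equation is eliminated from the others, the smaller system is solved on
  \<open>S - {p}\<close>, and the first equation then fixes the value at \<open>p\<close>.\<close>

lemma homogeneous_system_nontrivial:
  fixes as :: "('a \<Rightarrow> real) list"
  assumes "finite S" "length as < card S"
  shows "\<exists>x. (\<exists>u\<in>S. x u \<noteq> 0) \<and> (\<forall>a\<in>set as. (\<Sum>u\<in>S. a u * x u) = 0)"
  using assms
proof (induction "length as" arbitrary: as S)
  case 0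
  then have "S \<noteq> {}" by auto
  with 0 show ?case by (intro exI[of _ "\<lambda>_. 1"]) auto
next
  case (Suc m)
  then obtain a bs where as: "as = a # bs" and m: "m = length bs"
    by (cases as) auto
  show ?case
  proof (cases "\<forall>u\<in>S. a u = 0")
    case True
    have "length bs < card S" using Suc.prems as by simp
    then obtain x where "\<exists>u\<in>S. x u \<noteq> 0" "\<forall>a\<in>set bs. (\<Sum>u\<in>S. a u * x u) = 0"
      using Suc.hyps(1)[OF m Suc.prems(1)] by blast
    with True as show ?thesis by (intro exI[of _ x]) auto
  next
    case False
    then obtain p where p: "p \<in> S" "a p \<noteq> 0" by blast
    define cs where "cs = map (\<lambda>b u. b u - b p / a p * a u) bs"
    have "length cs < card (S - {p})"
      using Suc.prems p as by (simp add: cs_def)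
    moreover have "m = length cs" using m by (simp add: cs_def)
    ultimately obtain x where x: "\<exists>u\<in>S - {p}. x u \<noteq> 0"
      and x0: "\<forall>c\<in>set cs. (\<Sum>u\<in>S - {p}. c u * x u) = 0"
      using Suc.hyps(1)[of cs "S - {p}"] Suc.prems(1) by blast
    define y where "y = x(p := - (\<Sum>u\<in>S - {p}. a u * x u) / a p)"
    have split: "(\<Sum>u\<in>S. b u * y u)
        = (\<Sum>u\<in>S - {p}. b u * x u) - b p / a p * (\<Sum>u\<in>S - {p}. a u * x u)" for b
      using Suc.prems(1) p by (subst sum.remove[of _ p]) (auto simp: y_def)
    have "(\<Sum>u\<in>S. b u * y u) = 0" if "b \<in> set bs" for b
    proof -
      have "(\<Sum>u\<in>S - {p}. (b u - b p / a p * a u) * x u) = 0"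
        using x0 that by (auto simp: cs_def)
      then show ?thesis
        unfolding split by (simp add: left_diff_distrib sum_subtractf sum_distrib_left mult.assoc)
    qed
    moreover have "(\<Sum>u\<in>S. a u * y u) = 0" unfolding split using p by simp
    moreover have "\<exists>u\<in>S. y u \<noteq> 0" using x by (auto simp: y_def)
    ultimately show ?thesis using as by (intro exI[of _ y]) auto
  qed
qed

text \<open>Strict diagonal dominance after rescaling by \<open>c\<close>: by AM-GM each
  off-diagonal term is at least minus the two shares \<open>h u v\<close> and \<open>h v u\<close>,
  and by \<open>dom\<close> the shares at \<open>u\<close> add up to less than
  \<open>m u * (x u)\<^sup>2\<close> wherever \<open>x u\<close> is nonzero.\<close>

lemma quadratic_form_pos:
  fixes w :: "'a \<Rightarrow> 'a \<Rightarrow> real"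
  assumes fin: "finite S"
    and sym: "\<And>u v. u \<in> S \<Longrightarrow> v \<in> S \<Longrightarrow> w u v = w v u"
    and nonneg: "\<And>u v. u \<in> S \<Longrightarrow> v \<in> S \<Longrightarrow> w u v \<ge> 0"
    and c: "\<And>u. u \<in> S \<Longrightarrow> c u > 0"
    and dom: "\<And>u. u \<in> S \<Longrightarrow> (\<Sum>v\<in>S. w u v * c v) < m u * c u"
    and nz: "\<exists>u\<in>S. x u \<noteq> 0"
  shows "(\<Sum>u\<in>S. m u * (x u)\<^sup>2) + (\<Sum>u\<in>S. \<Sum>v\<in>S. w u v * (x u * x v)) > 0"
proof -
  define h where "h u v = w u v * c v / c u * (x u)\<^sup>2" for u v
  have amgm: "- (h u v + h v u) \<le> 2 * (w u v * (x u * x v))" if "u \<in> S" "v \<in> S" for u v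
  proof -
    \<comment> \<open>Weighting the square by \<open>1 / (c u * c v)\<close> makes its cross term
      exactly \<open>2 * w u v * x u * x v\<close>; symmetry of \<open>w\<close> identifies the
      second square term with \<open>h v u\<close>.\<close>
    have "0 \<le> w u v / (c u * c v) * (c v * x u + c u * x v)\<^sup>2"
      using that c[of u] c[of v] nonneg by simp
    also have "\<dots> = h u v + h v u + 2 * (w u v * (x u * x v))"
      using that c[of u] c[of v] sym[of u v]
      by (simp add: h_def field_simps power2_eq_square)
    finally show ?thesis by simp
  qed
  have "(\<Sum>u\<in>S. \<Sum>v\<in>S. - (h u v + h v u)) \<le> (\<Sum>u\<in>S. \<Sum>v\<in>S. 2 * (w u v * (x u * x v)))"
    by (intro sum_mono amgm)
  moreover have "(\<Sum>u\<in>S. \<Sum>v\<in>S. h v u) = (\<Sum>u\<in>S. \<Sum>v\<in>S. h u v)"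
    by (rule sum.swap)
  ultimately have "- (\<Sum>u\<in>S. \<Sum>v\<in>S. h u v) \<le> (\<Sum>u\<in>S. \<Sum>v\<in>S. w u v * (x u * x v))"
    by (simp add: sum_negf sum.distrib sum_distrib_left[symmetric] sum_subtractf)
  moreover have "(\<Sum>u\<in>S. \<Sum>v\<in>S. h u v) < (\<Sum>u\<in>S. m u * (x u)\<^sup>2)"
  proof (rule sum_strict_mono_ex1[OF fin])
    have h: "(\<Sum>v\<in>S. h u v) = (\<Sum>v\<in>S. w u v * c v) / c u * (x u)\<^sup>2" for u
      by (simp add: h_def sum_distrib_right sum_divide_distrib)
    have lt: "(\<Sum>v\<in>S. w u v * c v) / c u < m u" if "u \<in> S" for u
      using dom[OF that] c[OF that] by (simp add: pos_divide_less_eq)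
    show "\<forall>u\<in>S. (\<Sum>v\<in>S. h u v) \<le> m u * (x u)\<^sup>2"
      unfolding h using lt by (intro ballI mult_right_mono) (auto intro: less_imp_le)
    from nz obtain u where "u \<in> S" "x u \<noteq> 0" by blast
    then show "\<exists>u\<in>S. (\<Sum>v\<in>S. h u v) < m u * (x u)\<^sup>2"
      unfolding h using lt by (intro bexI[of _ u] mult_strict_right_mono) auto
  qed
  ultimately show ?thesis by linarith
qed

text \<open>The Caro--Tuza weight of a vertex of degree \<open>x\<close> for subgraphs of maximum degree below \<open>N\<close>. On the
  hyperbola, the decrement from \<open>x - 1\<close> to \<open>x\<close> is the \<open>x\<close>-th part of the value at \<open>x\<close>, so deleting a
  vertex of maximum degree does not decrease the total weight.\<close>

definition caro_tuza :: "real \<Rightarrow> real \<Rightarrow> real" where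
  "caro_tuza N x = (if x \<le> N then 1 - x / (2 * N) else (N + 1) / (2 * (x + 1)))"

section \<open>Lower bounds and decrements of the Caro-Tuza weight\<close>

lemma caro_tuza_le_1:
  assumes "N \<ge> 1" "x \<ge> 0"
  shows "caro_tuza N x \<le> 1"
  using assms by (auto simp: caro_tuza_def field_simps)

text \<open>Line and hyperbola meet exactly at \<open>N - 1\<close> and \<open>N\<close>: with
  denominators cleared, their difference is \<open>(x - N) * (x + 1 - N)\<close>, which is positive
  beyond \<open>N\<close>.\<close>

lemma caro_tuza_ge_linear:
  assumes "N \<ge> 1" "x \<ge> 0"
  shows "1 - x / (2 * N) \<le> caro_tuza N x"
proof (cases "x \<le> N")
  case False
  then have "0 \<le> (x - N) * (x + 1 - N)" using assms by simp
  then have "(2 * N - x) * (x + 1) \<le> N * (N + 1)" by (simp add: algebra_simps)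
  then show ?thesis using False assms by (simp add: caro_tuza_def field_simps)
qed (simp add: caro_tuza_def)

text \<open>Between \<open>N - 1\<close> and \<open>N\<close> the same product is nonpositive, so
  the hyperbola remains a lower bound for one unit below the breakpoint.\<close>

lemma caro_tuza_ge_hyperbola:
  assumes "N \<ge> 1" "x \<ge> N - 1"
  shows "(N + 1) / (2 * (x + 1)) \<le> caro_tuza N x"
proof (cases "x \<le> N")
  case True
  then have "0 \<le> (N - x) * (x + 1 - N)" using assms by simp
  then have "N * (N + 1) \<le> (2 * N - x) * (x + 1)" by (simp add: algebra_simps)
  then show ?thesis using True assms by (simp add: caro_tuza_def field_simps)
qed (simp add: caro_tuza_def)

text \<open>The weight decreases, so on \<open>[0, D]\<close> it is smallest at \<open>D\<close>;
  the left side is its value there.\<close>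

lemma caro_tuza_ge_at:
  assumes "N \<ge> 1" "0 \<le> x" "x \<le> D" "N \<le> D"
  shows "(N + 1) / (2 * (D + 1)) \<le> caro_tuza N x"
proof (cases "x \<le> N")
  case True
  then have "x / (2 * N) \<le> 1 / 2" "(N + 1) / (2 * (D + 1)) \<le> 1 / 2"
    using assms by (auto simp: field_simps)
  then have "(N + 1) / (2 * (D + 1)) \<le> 1 - x / (2 * N)" by linarith
  then show ?thesis using True by (simp only: caro_tuza_def if_True)
next
  case False
  then show ?thesis
    using assms by (simp add: caro_tuza_def) (intro divide_left_mono mult_pos_pos; simp)
qed

text \<open>AM-GM for two terms whose product \<open>c * (N + 1) / 2\<close> does not depend on
  \<open>y\<close>.\<close>

lemma sqrt_le_hyperbola_plus_linear:
  fixes N c y :: real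
  assumes "N \<ge> 1" "c \<ge> 0" "y > 0"
  shows "sqrt (2 * c * (N + 1)) \<le> (N + 1) / (2 * y) + c * y"
proof (rule real_le_lsqrt)
  have "0 \<le> ((N + 1) / (2 * y) - c * y)\<^sup>2" by simp
  also have "\<dots> = ((N + 1) / (2 * y) + c * y)\<^sup>2 - 4 * ((N + 1) / (2 * y) * (c * y))"
    by (simp add: power2_sum power2_diff)
  also have "4 * ((N + 1) / (2 * y) * (c * y)) = 2 * c * (N + 1)"
    using assms by simp
  finally show "2 * c * (N + 1) \<le> ((N + 1) / (2 * y) + c * y)\<^sup>2" by simp
qed (use assms in simp)

text \<open>Up to \<open>N\<close> the line falls with slope \<open>1 / (2 * N)\<close>, at least as
  fast as \<open>c * (x + 1)\<close> grows, so the worst case there is \<open>x = N\<close>; from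
  \<open>N\<close> on AM-GM applies with \<open>y = x + 1\<close>.\<close>

lemma caro_tuza_ge_sqrt:
  assumes "N \<ge> 1" "0 \<le> c" "c \<le> 1 / (2 * N)" "0 \<le> x"
  shows "sqrt (2 * c * (N + 1)) \<le> caro_tuza N x + c * (x + 1)"
proof (cases "x \<le> N")
  case True
  have "sqrt (2 * c * (N + 1)) \<le> (N + 1) / (2 * (N + 1)) + c * (N + 1)"
    using assms by (intro sqrt_le_hyperbola_plus_linear) auto
  also have "(N + 1) / (2 * (N + 1)) = 1 - N / (2 * N)" using assms by simp
  also have "c * (N + 1) = c * (N - x) + c * (x + 1)" by (simp add: algebra_simps)
  also have "c * (N - x) \<le> 1 / (2 * N) * (N - x)"
    using assms True by (intro mult_right_mono) auto
  also have "1 / (2 * N) * (N - x) = N / (2 * N) - x / (2 * N)"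
    by (simp add: diff_divide_distrib)
  finally show ?thesis using True by (simp add: caro_tuza_def)
next
  case False
  then show ?thesis using sqrt_le_hyperbola_plus_linear[of N c "x + 1"] assms
    by (simp add: caro_tuza_def)
qed

text \<open>The left side is the drop of the hyperbola \<open>(N + 1) / (2 * (x + 1))\<close> from
  \<open>D - 1\<close> to \<open>D\<close>; at \<open>D = N\<close> it equals the slope of the
  line.\<close>

lemma hyperbola_slope_le:
  fixes N D :: real
  assumes "N \<ge> 1" "D \<ge> N"
  shows "(N + 1) / (2 * (D * (D + 1))) \<le> 1 / (2 * N)"
proof -
  have "N * (N + 1) \<le> D * (D + 1)" using assms by (intro mult_mono) auto
  then have "(N + 1) / (2 * (D * (D + 1))) \<le> (N + 1) / (2 * (N * (N + 1)))"
    using assms by (intro divide_left_mono mult_pos_pos) auto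
  also have "\<dots> = 1 / (2 * N)" using assms by (simp add: divide_simps)
  finally show ?thesis .
qed

text \<open>By convexity, each unit removed from a degree at most \<open>D\<close> gains at least
  the last unit drop at \<open>D\<close>. On the hyperbola at \<open>x = D\<close> the mean gain
  reaches this value only for \<open>w \<ge> 1\<close>, hence the condition on
  \<open>w\<close>.\<close>

lemma caro_tuza_decrement:
  assumes N: "N \<ge> 1" and "D \<ge> N" "x \<le> D" "0 \<le> x - w" and w: "w = 0 \<or> w \<ge> 1"
  shows "w * ((N + 1) / (2 * (D * (D + 1)))) \<le> caro_tuza N (x - w) - caro_tuza N x"
proof -
  define p where "p = (N + 1) / (2 * (D * (D + 1)))"
  have p1: "p \<le> 1 / (2 * N)" unfolding p_def using assms by (intro hyperbola_slope_le)
  have p0: "p \<ge> 0" using assms by (simp add: p_def)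
  consider "w = 0" | "w \<ge> 1" "x \<le> N" | "w \<ge> 1" "x > N" "x - w \<ge> N - 1"
    | "w \<ge> 1" "x > N" "x - w < N - 1"
    using w by linarith
  then have "w * p \<le> caro_tuza N (x - w) - caro_tuza N x"
  proof cases
    case 1
    then show ?thesis by simp
  next
    case 2
    then have "caro_tuza N (x - w) - caro_tuza N x = w * (1 / (2 * N))"
      by (simp add: caro_tuza_def diff_divide_distrib)
    then show ?thesis using p1 2 by (metis mult_left_mono order_trans zero_le_one)
  next
    case 3
    have "(x - w + 1) * (x + 1) \<le> D * (D + 1)" using assms 3 by (intro mult_mono) auto
    then have "w * p \<le> w * ((N + 1) / (2 * ((x - w + 1) * (x + 1))))"
      unfolding p_def using 3 assms
      by (intro mult_left_mono divide_left_mono mult_pos_pos) auto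
    also have "\<dots> = (N + 1) / (2 * (x - w + 1)) - (N + 1) / (2 * (x + 1))"
    proof -
      have "2 * (x - w + 1) \<noteq> 0" "2 * (x + 1) \<noteq> 0" using 3 assms by auto
      then show ?thesis by (simp add: divide_simps) (simp add: algebra_simps)
    qed
    also have "\<dots> \<le> caro_tuza N (x - w) - caro_tuza N x"
      using caro_tuza_ge_hyperbola[of N "x - w"] 3 N by (simp add: caro_tuza_def)
    finally show ?thesis .
  next
    case 4
    \<comment> \<open>The descent is split at \<open>N - 1\<close>, where line and hyperbola agree:
      the hyperbola accounts for \<open>x - N + 1\<close> units and the line for the rest.\<close>
    have "N * (x + 1) \<le> D * (D + 1)" using assms by (intro mult_mono) auto
    then have "(x - N + 1) * p \<le> (x - N + 1) * ((N + 1) / (2 * (N * (x + 1))))"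
      unfolding p_def using 4 assms
      by (intro mult_left_mono divide_left_mono mult_pos_pos) auto
    moreover have "(N - 1 - (x - w)) * p \<le> (N - 1 - (x - w)) * (1 / (2 * N))"
      using p1 4 by (intro mult_left_mono) auto
    moreover have "w * p = (x - N + 1) * p + (N - 1 - (x - w)) * p"
      by (simp add: algebra_simps)
    moreover have "caro_tuza N (x - w) - caro_tuza N x
        = (x - N + 1) * ((N + 1) / (2 * (N * (x + 1)))) + (N - 1 - (x - w)) * (1 / (2 * N))"
    proof -
      have "N \<noteq> 0" "x + 1 \<noteq> 0" using 4 assms by auto
      moreover have "x - w \<le> N" "\<not> x \<le> N" using 4 by auto
      ultimately show ?thesis
        by (simp add: caro_tuza_def divide_simps) (simp add: algebra_simps)
    qed
    ultimately show ?thesis by linarith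
  qed
  then show ?thesis by (simp add: p_def)
qed

section \<open>Greedy deletion of points of maximum degree\<close>

text \<open>Here \<open>e u\<close> stands for the weight of edges from \<open>u\<close> to points that are never deleted; the
  term \<open>e u / (2 * N)\<close> is refunded when \<open>u\<close> is deleted.\<close>

lemma low_degree_subset:
  fixes w :: "'a \<Rightarrow> 'a \<Rightarrow> real" and e :: "'a \<Rightarrow> real"
  assumes "finite T" and N: "N \<ge> 1"
    and e: "\<And>u. u \<in> T \<Longrightarrow> e u \<ge> 0"
    and sym: "\<And>u v. u \<in> T \<Longrightarrow> v \<in> T \<Longrightarrow> w u v = w v u"
    and diag: "\<And>u. u \<in> T \<Longrightarrow> w u u = 0"
    and int: "\<And>u v. u \<in> T \<Longrightarrow> v \<in> T \<Longrightarrow> w u v = 0 \<or> w u v \<ge> 1"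
  shows "\<exists>T'\<subseteq>T. (\<forall>u\<in>T'. e u + (\<Sum>v\<in>T'. w u v) < N) \<and>
    (\<Sum>u\<in>T. caro_tuza N (e u + (\<Sum>v\<in>T. w u v)) - e u / (2 * N)) \<le> real (card T')"
  using assms(1) e sym diag int
proof (induction "card T" arbitrary: T rule: less_induct)
  case less
  define \<delta> where "\<delta> u = e u + (\<Sum>v\<in>T. w u v)" for u
  have w0: "w u v \<ge> 0" if "u \<in> T" "v \<in> T" for u v
    using less.prems(5)[OF that] by linarith
  have \<delta>0: "\<delta> u \<ge> 0" if "u \<in> T" for u
    unfolding \<delta>_def using that less.prems(2) w0 by (intro add_nonneg_nonneg sum_nonneg) auto
  show ?case
  proof (cases "\<forall>u\<in>T. \<delta> u < N")
    case True
    have "(\<Sum>u\<in>T. caro_tuza N (\<delta> u) - e u / (2 * N)) \<le> (\<Sum>u\<in>T. 1)"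
    proof (intro sum_mono)
      fix u assume "u \<in> T"
      then have "caro_tuza N (\<delta> u) \<le> 1" "0 \<le> e u / (2 * N)"
        using caro_tuza_le_1 N \<delta>0 less.prems(2) by auto
      then show "caro_tuza N (\<delta> u) - e u / (2 * N) \<le> 1" by linarith
    qed
    then show ?thesis using True by (intro exI[of _ T]) (auto simp: \<delta>_def)
  next
    case False
    then obtain u0 where u0: "u0 \<in> T" "\<delta> u0 \<ge> N" by force
    have "Max (\<delta> ` T) \<in> \<delta> ` T" using less.prems(1) u0 by (intro Max_in) auto
    then obtain u where u: "u \<in> T" "\<delta> u = Max (\<delta> ` T)" by auto
    have max: "\<delta> v \<le> \<delta> u" if "v \<in> T" for v
      using that less.prems(1) u by simp
    have \<Delta>: "\<delta> u \<ge> N" using max[of u0] u0 by simp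
    define p where "p = (N + 1) / (2 * (\<delta> u * (\<delta> u + 1)))"
    define T1 where "T1 = T - {u}"
    have fT1: "finite T1" using less.prems(1) by (simp add: T1_def)
    have \<delta>T1: "e v + (\<Sum>z\<in>T1. w v z) = \<delta> v - w u v" if "v \<in> T" for v
      using less.prems(1,3) u that by (simp add: T1_def \<delta>_def sum_diff1)
    \<comment> \<open>Since \<open>\<delta> u\<close> is the maximum degree, it can serve as
      \<open>D\<close> for every remaining point, so all gains are measured by the same
      \<open>p\<close>.\<close>
    have step: "(caro_tuza N (\<delta> v) - e v / (2 * N)) + w u v * p
        \<le> caro_tuza N (\<delta> v - w u v) - e v / (2 * N)" if "v \<in> T1" for v
    proof -
      have v: "v \<in> T" using that by (simp add: T1_def)
      have "0 \<le> e v + (\<Sum>z\<in>T1. w v z)"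
        using v w0 less.prems(2) by (intro add_nonneg_nonneg sum_nonneg) (auto simp: T1_def)
      then have "w u v * p \<le> caro_tuza N (\<delta> v - w u v) - caro_tuza N (\<delta> v)"
        unfolding p_def using \<delta>T1[OF v] max[OF v] \<Delta> N less.prems(5)[OF u(1) v]
        by (intro caro_tuza_decrement) auto
      then show ?thesis by linarith
    qed
    have p1: "p \<le> 1 / (2 * N)" unfolding p_def using \<Delta> N by (intro hyperbola_slope_le)
    have cu: "caro_tuza N (\<delta> u) = \<delta> u * p"
    proof (cases "\<delta> u = N")
      case True
      moreover have "N \<noteq> 0" "N + 1 \<noteq> 0" using N by auto
      ultimately show ?thesis by (simp add: caro_tuza_def p_def)
    next
      case False
      then show ?thesis using \<Delta> N by (simp add: caro_tuza_def p_def)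
    qed
    \<comment> \<open>Only \<open>\<delta> u - e u\<close> of the degree of \<open>u\<close> goes to
      points that gain from the deletion; the missing \<open>e u * p\<close> is covered by the
      refund \<open>e u / (2 * N)\<close>.\<close>
    have "e u * p \<le> e u * (1 / (2 * N))"
      using p1 less.prems(2) u by (intro mult_left_mono) auto
    moreover have "(\<Sum>v\<in>T1. w u v) = \<delta> u - e u"
      using \<delta>T1[OF u(1)] less.prems(4)[OF u(1)] by simp
    ultimately have lost: "caro_tuza N (\<delta> u) - e u / (2 * N) \<le> (\<Sum>v\<in>T1. w u v) * p"
      unfolding cu by (simp add: left_diff_distrib)
    have "(\<Sum>v\<in>T. caro_tuza N (\<delta> v) - e v / (2 * N))
        = (caro_tuza N (\<delta> u) - e u / (2 * N)) + (\<Sum>v\<in>T1. caro_tuza N (\<delta> v) - e v / (2 * N))"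
      unfolding T1_def using less.prems(1) u(1) by (rule sum.remove)
    also have "\<dots> \<le> (\<Sum>v\<in>T1. (caro_tuza N (\<delta> v) - e v / (2 * N)) + w u v * p)"
      using lost by (simp add: sum.distrib sum_distrib_right)
    also have "\<dots> \<le> (\<Sum>v\<in>T1. caro_tuza N (\<delta> v - w u v) - e v / (2 * N))"
      by (intro sum_mono step)
    also have "\<dots> = (\<Sum>v\<in>T1. caro_tuza N (e v + (\<Sum>z\<in>T1. w v z)) - e v / (2 * N))"
      using \<delta>T1 by (intro sum.cong) (auto simp: T1_def simp del: sum_diff1)
    finally have le: "(\<Sum>v\<in>T. caro_tuza N (\<delta> v) - e v / (2 * N)) \<le> \<dots>" .
    have "card T1 < card T"
      using u less.prems(1) unfolding T1_def by (intro psubset_card_mono) auto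
    from less.hyps[OF this fT1] less.prems(2-5) obtain T' where T': "T' \<subseteq> T1"
      "\<forall>u\<in>T'. e u + (\<Sum>v\<in>T'. w u v) < N"
      "(\<Sum>u\<in>T1. caro_tuza N (e u + (\<Sum>v\<in>T1. w u v)) - e u / (2 * N)) \<le> real (card T')"
      by (auto simp: T1_def)
    then show ?thesis using le by (intro exI[of _ T']) (auto simp: \<delta>_def T1_def)
  qed
qed

section \<open>Gram matrix of the points of a block multiset\<close>

text \<open>The Gram matrix of the incidence vectors of the points; its diagonal holds the
  replication numbers.\<close>

definition block_count :: "'a set multiset \<Rightarrow> 'a \<Rightarrow> 'a \<Rightarrow> nat" where
  "block_count M u v = size {#B \<in># M. u \<in> B \<and> v \<in> B#}"

lemma block_count_commute: "block_count M u v = block_count M v u"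
  by (simp add: block_count_def conj_commute)

text \<open>Double counting of incidences. Taking for \<open>P\<close> membership of a fixed point
  gives the row sums of \<open>block_count\<close>; taking it always true gives the sum of all
  replication numbers.\<close>

lemma sum_size_filter_mem:
  assumes "finite V" "\<forall>B\<in>#M. B \<subseteq> V \<and> card B = k"
  shows "(\<Sum>v\<in>V. size {#B \<in># M. P B \<and> v \<in> B#}) = k * size {#B \<in># M. P B#}"
  using assms(2)
proof (induction M)
  case (add B M)
  have "(\<Sum>v\<in>V. of_bool (v \<in> B) :: nat) = card (V \<inter> B)"
    using assms(1) by (simp add: of_bool_def sum.If_cases)
  also have "V \<inter> B = B" using add.prems by auto
  finally have "(\<Sum>v\<in>V. of_bool (v \<in> B) :: nat) = k" using add.prems by simp
  moreover have "size {#C \<in># add_mset B M. P C \<and> v \<in> C#}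
      = of_bool (P B) * of_bool (v \<in> B) + size {#C \<in># M. P C \<and> v \<in> C#}" for v
    by simp
  ultimately show ?case using add
    by (simp only: sum.distrib sum_distrib_left[symmetric]) simp
qed simp

lemma sum_mset_square_eq_block_count:
  "(\<Sum>B\<in>#M. (\<Sum>u\<in>S. of_bool (u \<in> B) * x u)\<^sup>2)
     = (\<Sum>u\<in>S. \<Sum>v\<in>S. real (block_count M u v) * (x u * x v))"
proof (induction M)
  case (add B M)
  have "(\<Sum>u\<in>S. of_bool (u \<in> B) * x u)\<^sup>2
      = (\<Sum>u\<in>S. \<Sum>v\<in>S. of_bool (u \<in> B \<and> v \<in> B) * (x u * x v))"
    unfolding power2_eq_square sum_product by (intro sum.cong) auto
  moreover have "real (block_count (add_mset B M) u v)
      = of_bool (u \<in> B \<and> v \<in> B) + real (block_count M u v)" for u v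
    by (simp add: block_count_def)
  ultimately show ?case
    using add by (simp only: image_mset_add_mset sum_mset.add_mset distrib_right sum.distrib)
qed (simp add: block_count_def)

text \<open>With fewer blocks than points some nonzero \<open>x\<close> is orthogonal to every
  block, and the form, being a sum of squares over blocks, vanishes at it.\<close>

lemma card_le_size_if_pos_def:
  assumes "finite S"
    and pos: "\<And>x. \<exists>u\<in>S. x u \<noteq> 0 \<Longrightarrow>
      (\<Sum>u\<in>S. \<Sum>v\<in>S. real (block_count M u v) * (x u * x v)) > 0"
  shows "card S \<le> size M"
proof (rule ccontr)
  assume less: "\<not> card S \<le> size M"
  obtain Bs where Bs: "mset Bs = M" using ex_mset by blast
  define as where "as = map (\<lambda>B u. of_bool (u \<in> B) :: real) Bs"
  have "length as < card S" using less Bs by (auto simp: as_def)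
  from homogeneous_system_nontrivial[OF assms(1) this] obtain x where
    x: "\<exists>u\<in>S. x u \<noteq> 0" "\<forall>a\<in>set as. (\<Sum>u\<in>S. a u * x u) = 0" by blast
  have "(\<Sum>B\<in>#M. (\<Sum>u\<in>S. of_bool (u \<in> B) * x u)\<^sup>2) = (\<Sum>B\<in>#M. 0)"
    using x(2) by (intro arg_cong[of _ _ sum_mset] image_mset_cong) (auto simp: as_def simp flip: Bs)
  then show False using pos[OF x(1)] by (simp add: sum_mset_square_eq_block_count)
qed

section \<open>Excess degrees in a covering with \<open>d < n\<close>\<close>

locale small_covering =
  fixes v k lam :: nat and V :: "'a set" and M :: "'a set multiset" and r d n :: int
  assumes cov: "covering v k lam V M"
    and k3: "3 \<le> k" and kv: "k < v"
    and eq: "int lam * (int v - 1) = r * (int k - 1) - d"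
    and d0: "0 \<le> d" and dk: "d < int k - 1"
    and n: "n = r - int lam"
    and rk: "r < int k"
    and lam0: "lam > 0"
    and dn: "d < n"
begin

text \<open>The diagonal is set to zero so that this is the weight of a loopless graph; the diagonal
  of the Gram matrix is treated separately.\<close>

definition excess :: "'a \<Rightarrow> 'a \<Rightarrow> real" where
  "excess u w = (if u = w then 0 else real (block_count M u w) - real lam)"

definition replication :: "'a \<Rightarrow> int" where
  "replication u = int (block_count M u u)"

definition V0 where "V0 = {u \<in> V. replication u = r}"
definition V1 where "V1 = {u \<in> V. replication u = r + 1}"

definition q :: real where "q = real_of_int d / real_of_int n"

definition to_V0 :: "'a \<Rightarrow> real" where "to_V0 u = (\<Sum>w\<in>V0. excess u w)"
definition to_V1 :: "'a \<Rightarrow> real" where "to_V1 u = (\<Sum>w\<in>V1. excess u w)"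

lemma finV: "finite V" and cardV: "card V = v"
  and blocks: "\<forall>B\<in>#M. B \<subseteq> V \<and> card B = k"
  and pairs: "u \<in> V \<Longrightarrow> w \<in> V \<Longrightarrow> u \<noteq> w \<Longrightarrow> lam \<le> block_count M u w"
  using cov by (auto simp: covering_def block_count_def)

lemma V0V: "V0 \<subseteq> V" and V1V: "V1 \<subseteq> V" and disj: "V0 \<inter> V1 = {}"
  by (auto simp: V0_def V1_def)

lemma finV0: "finite V0" and finV1: "finite V1"
  using finV V0V V1V finite_subset by auto

lemma excess_commute: "excess u w = excess w u"
  by (simp add: excess_def block_count_commute)

lemma excess_self [simp]: "excess u u = 0"
  by (simp add: excess_def)

lemma excess_nonneg: "u \<in> V \<Longrightarrow> w \<in> V \<Longrightarrow> excess u w \<ge> 0"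
  using pairs[of u w] by (auto simp: excess_def)

lemma excess_zero_or_ge_1: "u \<in> V \<Longrightarrow> w \<in> V \<Longrightarrow> excess u w = 0 \<or> excess u w \<ge> 1"
  using pairs[of u w] by (cases "u = w") (simp_all add: excess_def, linarith)

text \<open>The row of \<open>u\<close> in \<open>block_count\<close> sums to \<open>k\<close> times
  its replication number; subtract the diagonal entry and
  \<open>lam * (v - 1) = r * (k - 1) - d\<close>.\<close>

lemma excess_degree:
  assumes "u \<in> V"
  shows "(\<Sum>w\<in>V. excess u w)
    = real_of_int ((replication u - r) * (int k - 1) + d)"
proof -
  have "(\<Sum>w\<in>V. block_count M u w) = k * block_count M u u"
    using sum_size_filter_mem[OF finV blocks, of "\<lambda>B. u \<in> B"] by (simp add: block_count_def)
  then have "(\<Sum>w\<in>V. real (block_count M u w)) = real k * real (block_count M u u)"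
    by (metis of_nat_mult of_nat_sum)
  then have "(\<Sum>w\<in>V - {u}. real (block_count M u w)) = (real k - 1) * real_of_int (replication u)"
    using sum.remove[OF finV assms, of "\<lambda>w. real (block_count M u w)"]
    by (simp add: replication_def algebra_simps)
  moreover have "(\<Sum>w\<in>V. excess u w) = (\<Sum>w\<in>V - {u}. real (block_count M u w) - real lam)"
    by (subst sum.remove[OF finV assms]) (auto simp: excess_def intro!: sum.cong split: if_splits)
  moreover have "real (card (V - {u})) = real v - 1"
    using assms cardV finV kv by (simp add: of_nat_diff)
  moreover have "real lam * (real v - 1) = real_of_int r * (real k - 1) - real_of_int d"
    using arg_cong[OF eq, of real_of_int] by simp
  ultimately show ?thesis by (simp add: sum_subtractf algebra_simps)
qed

text \<open>A point on fewer than \<open>r\<close> blocks would have excess degree at most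
  \<open>d - (k - 1) < 0\<close>.\<close>

lemma replication_ge:
  assumes "u \<in> V"
  shows "replication u \<ge> r"
proof (rule ccontr)
  assume "\<not> replication u \<ge> r"
  then have "(replication u - r) * (int k - 1) \<le> (-1) * (int k - 1)"
    using k3 by (intro mult_right_mono) auto
  moreover have "x \<le> (-1) * y \<Longrightarrow> d < y \<Longrightarrow> x + d < 0" for x y :: int by simp
  ultimately have "(replication u - r) * (int k - 1) + d < 0" using dk by blast
  then have "(\<Sum>w\<in>V. excess u w) < 0" unfolding excess_degree[OF assms] by linarith
  moreover have "(\<Sum>w\<in>V. excess u w) \<ge> 0" using excess_nonneg assms by (intro sum_nonneg) auto
  ultimately show False by simp
qed

lemma excess_degree_V0: "u \<in> V0 \<Longrightarrow> (\<Sum>w\<in>V. excess u w) = real_of_int d"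
  using excess_degree by (auto simp: V0_def)

lemma excess_degree_V1: "u \<in> V1 \<Longrightarrow> (\<Sum>w\<in>V. excess u w) = real_of_int d + real k - 1"
  using excess_degree by (auto simp: V1_def)

lemma n_pos: "real_of_int n \<ge> 1"
  using d0 dn by simp

lemma to_V0_nonneg: "u \<in> V \<Longrightarrow> to_V0 u \<ge> 0" and to_V1_nonneg: "u \<in> V \<Longrightarrow> to_V1 u \<ge> 0"
  unfolding to_V0_def to_V1_def using V0V V1V excess_nonneg by (auto intro!: sum_nonneg)

lemma to_V0_V1_le:
  assumes "u \<in> V"
  shows "to_V0 u + to_V1 u \<le> (\<Sum>w\<in>V. excess u w)"
proof -
  have "to_V0 u + to_V1 u = (\<Sum>w\<in>V0 \<union> V1. excess u w)"
    unfolding to_V0_def to_V1_def using finV0 finV1 disj by (simp add: sum.union_disjoint)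
  also have "\<dots> \<le> (\<Sum>w\<in>V. excess u w)"
    using finV V0V V1V excess_nonneg assms by (intro sum_mono2) auto
  finally show ?thesis .
qed

lemma q_nonneg: "q \<ge> 0" and q_less_1: "q < 1"
  using d0 dn n_pos by (auto simp: q_def)

section \<open>Bounding the number of blocks\<close>

text \<open>Diagonal dominance with scaling \<open>y\<close> on \<open>V0\<close> and
  \<open>1\<close> on \<open>T\<close>. Rows of \<open>V0\<close> need \<open>d < n * y\<close>,
  that is \<open>y > q\<close>; the finitely many strict inequalities on \<open>T\<close> hold at
  \<open>q\<close> and so persist for \<open>y\<close> slightly larger.\<close>

lemma independent_card_le:
  assumes T: "T \<subseteq> V1"
    and deg: "\<And>u. u \<in> T \<Longrightarrow> q * to_V0 u + (\<Sum>w\<in>T. excess u w) < real_of_int n + 1"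
  shows "card V0 + card T \<le> size M"
proof -
  have finT: "finite T" using T finV1 finite_subset by auto
  have disjT: "V0 \<inter> T = {}" using T disj by auto
  define S where "S = V0 \<union> T"
  have finS: "finite S" using finT finV0 by (simp add: S_def)
  have SV: "S \<subseteq> V" using T V0V V1V by (auto simp: S_def)
  have "\<forall>\<^sub>F y in at_right q. \<forall>u\<in>T. y * to_V0 u + (\<Sum>w\<in>T. excess u w) < real_of_int n + 1"
  proof (intro eventually_ball_finite finT ballI)
    fix u assume "u \<in> T"
    have "((\<lambda>y. y * to_V0 u + (\<Sum>w\<in>T. excess u w)) \<longlongrightarrow> q * to_V0 u + (\<Sum>w\<in>T. excess u w))
        (at_right q)" by (intro tendsto_intros)
    then show "\<forall>\<^sub>F y in at_right q. y * to_V0 u + (\<Sum>w\<in>T. excess u w) < real_of_int n + 1"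
      using deg[OF \<open>u \<in> T\<close>] by (rule order_tendstoD)
  qed
  moreover have "\<forall>\<^sub>F y in at_right q. y \<in> {q<..<1}"
    using q_less_1 by (rule eventually_at_right_real)
  ultimately have "\<forall>\<^sub>F y in at_right q. q < y \<and> y < 1 \<and>
      (\<forall>u\<in>T. y * to_V0 u + (\<Sum>w\<in>T. excess u w) < real_of_int n + 1)"
    by eventually_elim auto
  then obtain y where y: "q < y" "y < 1"
    and yT: "\<And>u. u \<in> T \<Longrightarrow> y * to_V0 u + (\<Sum>w\<in>T. excess u w) < real_of_int n + 1"
    using eventually_happens trivial_limit_at_right_real by blast
  have y0: "y > 0" using y q_nonneg by linarith
  define c where "c u = (if u \<in> V0 then y else 1)" for u
  define m where "m u = (if u \<in> V0 then real_of_int n else real_of_int n + 1)" for u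
  have sumc: "(\<Sum>w\<in>S. excess u w * c w) = y * to_V0 u + (\<Sum>w\<in>T. excess u w)" for u
  proof -
    have "(\<Sum>w\<in>S. excess u w * c w) = (\<Sum>w\<in>V0. excess u w * c w) + (\<Sum>w\<in>T. excess u w * c w)"
      unfolding S_def using finV0 finT disjT by (rule sum.union_disjoint)
    also have "(\<Sum>w\<in>V0. excess u w * c w) = y * to_V0 u"
      unfolding to_V0_def by (simp add: c_def sum_distrib_left mult.commute)
    also have "(\<Sum>w\<in>T. excess u w * c w) = (\<Sum>w\<in>T. excess u w)"
      using disjT by (intro sum.cong) (auto simp: c_def)
    finally show ?thesis .
  qed
  have dom: "(\<Sum>w\<in>S. excess u w * c w) < m u * c u" if "u \<in> S" for u
  proof (cases "u \<in> V0")
    case True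
    then have uV: "u \<in> V" using V0V by auto
    have "(\<Sum>w\<in>S. excess u w * c w) \<le> (\<Sum>w\<in>S. excess u w)"
      using excess_nonneg uV SV y y0 by (intro sum_mono) (auto simp: c_def mult_left_le)
    also have "\<dots> \<le> (\<Sum>w\<in>V. excess u w)"
      using excess_nonneg uV SV finV by (intro sum_mono2) auto
    also have "\<dots> = real_of_int d" using True by (rule excess_degree_V0)
    also have "\<dots> < real_of_int n * y"
      using y(1) n_pos by (simp add: q_def divide_less_eq mult.commute)
    finally show ?thesis using True by (simp add: c_def m_def)
  next
    case False
    then show ?thesis using that yT unfolding sumc by (auto simp: c_def m_def S_def)
  qed
  have "card S \<le> size M"
  proof (rule card_le_size_if_pos_def[OF finS])
    fix x :: "'a \<Rightarrow> real" assume nz: "\<exists>u\<in>S. x u \<noteq> 0"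
    have "0 < (\<Sum>u\<in>S. m u * (x u)\<^sup>2) + (\<Sum>u\<in>S. \<Sum>w\<in>S. excess u w * (x u * x w))"
    proof (rule quadratic_form_pos[OF finS excess_commute _ _ dom nz])
      show "excess u w \<ge> 0" if "u \<in> S" "w \<in> S" for u w
        using that SV by (intro excess_nonneg) auto
    qed (use y0 in \<open>simp_all add: c_def\<close>)
    \<comment> \<open>The all-ones part of the Gram matrix contributes a nonnegative square.\<close>
    also have "\<dots> \<le> real lam * (\<Sum>u\<in>S. x u)\<^sup>2 + \<dots>" by simp
    also have "\<dots> = (\<Sum>u\<in>S. \<Sum>w\<in>S. real (block_count M u w) * (x u * x w))"
    proof -
      have "real (block_count M u w) * (x u * x w) = real lam * (x u * x w)
          + ((if u = w then m u * (x u)\<^sup>2 else 0) + excess u w * (x u * x w))"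
        if "u \<in> S" "w \<in> S" for u w
      proof (cases "u = w")
        case True
        have "real_of_int (replication u) = real lam + m u"
          using that T n by (auto simp: S_def V0_def V1_def m_def)
        then have "real (block_count M u u) = real lam + m u" by (simp add: replication_def)
        then show ?thesis using True by (simp add: algebra_simps power2_eq_square)
      qed (simp add: excess_def algebra_simps)
      then have "(\<Sum>u\<in>S. \<Sum>w\<in>S. real (block_count M u w) * (x u * x w))
          = (\<Sum>u\<in>S. \<Sum>w\<in>S. real lam * (x u * x w)
             + ((if u = w then m u * (x u)\<^sup>2 else 0) + excess u w * (x u * x w)))"
        by (intro sum.cong) auto
      moreover have "real lam * (\<Sum>u\<in>S. x u)\<^sup>2 = (\<Sum>u\<in>S. \<Sum>w\<in>S. real lam * (x u * x w))"
        by (simp only: power2_eq_square sum_product) (simp only: sum_distrib_left)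
      ultimately show ?thesis using finS by (simp add: sum.distrib)
    qed
    finally show "0 < \<dots>" .
  qed
  then show ?thesis using finV0 finT disjT by (simp add: S_def card_Un_disjoint)
qed

text \<open>Greedy deletion inside \<open>V1\<close> with degree bound \<open>n + 1\<close>; the
  points of \<open>V0\<close> are never deleted and contribute
  \<open>e u = q * to_V0 u\<close>.\<close>

lemma size_ge_caro_tuza:
  "real (card V0) + (\<Sum>u\<in>V1. caro_tuza (real_of_int n + 1) (q * to_V0 u + to_V1 u)
      - q * to_V0 u / (2 * (real_of_int n + 1))) \<le> real (size M)"
proof -
  have "\<exists>T\<subseteq>V1. (\<forall>u\<in>T. q * to_V0 u + (\<Sum>w\<in>T. excess u w) < real_of_int n + 1) \<and>
    (\<Sum>u\<in>V1. caro_tuza (real_of_int n + 1) (q * to_V0 u + (\<Sum>w\<in>V1. excess u w))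
       - q * to_V0 u / (2 * (real_of_int n + 1))) \<le> real (card T)"
  proof (rule low_degree_subset)
    show "q * to_V0 u \<ge> 0" if "u \<in> V1" for u
      using that V1V q_nonneg to_V0_nonneg by (intro mult_nonneg_nonneg) auto
    show "excess u w = 0 \<or> excess u w \<ge> 1" if "u \<in> V1" "w \<in> V1" for u w
      using that V1V by (intro excess_zero_or_ge_1) auto
  qed (use n_pos in \<open>simp_all add: finV1 excess_commute\<close>)
  then obtain T where "T \<subseteq> V1"
    and "\<forall>u\<in>T. q * to_V0 u + (\<Sum>w\<in>T. excess u w) < real_of_int n + 1"
    and T: "(\<Sum>u\<in>V1. caro_tuza (real_of_int n + 1) (q * to_V0 u + to_V1 u)
       - q * to_V0 u / (2 * (real_of_int n + 1))) \<le> real (card T)"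
    unfolding to_V1_def by blast
  then have "card V0 + card T \<le> size M" by (intro independent_card_le) auto
  then show ?thesis using T by linarith
qed

text \<open>The linear function of the replication number with value \<open>\<alpha>\<close> at
  \<open>r\<close> and \<open>\<beta>\<close> at \<open>r + 1\<close> is at most
  \<open>2 * \<beta> - \<alpha> \<le> 0\<close> from \<open>r + 2\<close> on. Summed over all points
  it is thus bounded by \<open>bound\<close>; as the replication numbers sum to
  \<open>k * size M\<close>, this can be solved for \<open>size M\<close>.\<close>

lemma size_ge_CB:
  assumes bound: "\<alpha> * real (card V0) + \<beta> * real (card V1) \<le> real (size M)"
    and \<alpha>: "\<alpha> \<ge> 0" and \<beta>: "2 * \<beta> \<le> \<alpha>"
  shows "CB v k lam \<alpha> \<beta> \<le> real (size M)"
proof -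
  have "\<lceil>real lam * (real v - 1) / (real k - 1)\<rceil> = r"
  proof (rule ceiling_unique)
    have "real lam * (real v - 1) = real_of_int r * (real k - 1) - real_of_int d"
      using arg_cong[OF eq, of real_of_int] by simp
    then have "real lam * (real v - 1) / (real k - 1) = real_of_int r - real_of_int d / (real k - 1)"
      using k3 by (simp add: field_simps)
    moreover have "0 \<le> real_of_int d / (real k - 1)" "real_of_int d / (real k - 1) < 1"
      using d0 dk k3 by auto
    ultimately show "real_of_int r - 1 < real lam * (real v - 1) / (real k - 1)"
      "real lam * (real v - 1) / (real k - 1) \<le> real_of_int r" by auto
  qed
  then have CB: "CB v k lam \<alpha> \<beta> = (real_of_int r * real v * (\<alpha> - \<beta>) + \<alpha> * real v) / (real k * (\<alpha> - \<beta>) + 1)"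
    by (simp add: CB_def)
  have "(\<Sum>u\<in>V. block_count M u u) = k * size M"
    using sum_size_filter_mem[OF finV blocks, of "\<lambda>_. True"] by (simp add: block_count_def)
  then have deg: "(\<Sum>u\<in>V. real_of_int (replication u)) = real k * real (size M)"
    by (simp add: replication_def flip: of_nat_mult of_nat_sum)
  have "real v * \<alpha> - (\<alpha> - \<beta>) * (real k * real (size M) - real v * real_of_int r)
      = (\<Sum>u\<in>V. \<alpha> - (\<alpha> - \<beta>) * (real_of_int (replication u) - real_of_int r))"
    by (simp add: sum_subtractf sum_distrib_left[symmetric] deg cardV)
  also have "\<dots> \<le> (\<Sum>u\<in>V. (if u \<in> V0 then \<alpha> else 0) + (if u \<in> V1 then \<beta> else 0))"
  proof (rule sum_mono)
    fix u assume u: "u \<in> V"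
    consider "u \<in> V0" "u \<notin> V1" "replication u = r" | "u \<in> V1" "u \<notin> V0" "replication u = r + 1"
      | "u \<notin> V0" "u \<notin> V1" "replication u \<ge> r + 2"
      using replication_ge[OF u] u by (force simp: V0_def V1_def)
    then show "\<alpha> - (\<alpha> - \<beta>) * (real_of_int (replication u) - real_of_int r)
        \<le> (if u \<in> V0 then \<alpha> else 0) + (if u \<in> V1 then \<beta> else 0)"
    proof cases
      case 3
      then have "real_of_int (replication u) - real_of_int r \<ge> 2" by linarith
      then have "(\<alpha> - \<beta>) * 2 \<le> (\<alpha> - \<beta>) * (real_of_int (replication u) - real_of_int r)"
        using \<alpha> \<beta> by (intro mult_left_mono) auto
      then show ?thesis using 3 \<beta> by simp
    qed auto
  qed
  also have "\<dots> = \<alpha> * real (card V0) + \<beta> * real (card V1)"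
    using finV V0V V1V by (simp add: sum.distrib sum.If_cases Int_absorb1)
  also have "\<dots> \<le> real (size M)" by (rule bound)
  finally have "real_of_int r * real v * (\<alpha> - \<beta>) + \<alpha> * real v
      \<le> real (size M) * (real k * (\<alpha> - \<beta>) + 1)"
    by (simp add: algebra_simps)
  moreover have "real k * (\<alpha> - \<beta>) + 1 > 0"
    using \<alpha> \<beta> by (intro add_nonneg_pos mult_nonneg_nonneg) auto
  ultimately show ?thesis unfolding CB by (simp add: pos_divide_le_eq)
qed

text \<open>The edges between \<open>V0\<close> and \<open>V1\<close> are counted from the
  \<open>V0\<close> side, where degrees are \<open>d\<close>.\<close>

lemma sum_to_V0_le: "(\<Sum>u\<in>V1. to_V0 u) \<le> real_of_int d * real (card V0)"
proof -
  have "(\<Sum>u\<in>V1. to_V0 u) = (\<Sum>u\<in>V0. to_V1 u)"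
    unfolding to_V0_def to_V1_def by (subst sum.swap) (simp add: excess_commute)
  also have "\<dots> \<le> (\<Sum>u\<in>V0. real_of_int d)"
  proof (rule sum_mono)
    fix u assume u: "u \<in> V0"
    then have "u \<in> V" using V0V by auto
    then show "to_V1 u \<le> real_of_int d"
      using to_V0_V1_le to_V0_nonneg excess_degree_V0[OF u] by fastforce
  qed
  finally show ?thesis by (simp add: mult.commute)
qed

lemma V1_degrees:
  assumes "u \<in> V1"
  shows "to_V0 u \<ge> 0" "to_V1 u \<ge> 0" "to_V0 u + to_V1 u \<le> real_of_int d + real k - 1"
  using assms V1V to_V0_nonneg to_V1_nonneg to_V0_V1_le[of u] excess_degree_V1[OF assms] by auto

text \<open>Ensures that \<open>d + k - 1\<close>, the excess degree of a point of
  \<open>V1\<close>, is at least the breakpoint \<open>N = n + 1\<close>.\<close>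

lemma k_ge: "real_of_int n + 2 \<le> real k"
proof -
  have "n + 2 \<le> int k" using n rk lam0 by simp
  then show ?thesis by linarith
qed

lemma size_ge_CB_1:
  assumes "\<And>u. u \<in> V1 \<Longrightarrow> \<beta> \<le> caro_tuza (real_of_int n + 1) (q * to_V0 u + to_V1 u)
      - q * to_V0 u / (2 * (real_of_int n + 1))"
    and "2 * \<beta> \<le> 1"
  shows "CB v k lam 1 \<beta> \<le> real (size M)"
proof (rule size_ge_CB)
  have "(\<Sum>u\<in>V1. \<beta>) \<le> (\<Sum>u\<in>V1. caro_tuza (real_of_int n + 1) (q * to_V0 u + to_V1 u)
      - q * to_V0 u / (2 * (real_of_int n + 1)))"
    using assms(1) by (rule sum_mono)
  then show "1 * real (card V0) + \<beta> * real (card V1) \<le> real (size M)"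
    using size_ge_caro_tuza by (simp add: mult.commute)
qed (use assms(2) in auto)

section \<open>The three bounds\<close>

text \<open>The penalties \<open>q * to_V0 u / (2 * N)\<close> cost each point of \<open>V0\<close>
  at most \<open>q * d / (2 * N)\<close>, which gives \<open>\<alpha>\<close>;
  \<open>\<beta>\<close> is the Caro-Tuza weight at the largest possible degree
  \<open>d + k - 1\<close>.\<close>

lemma bound_a:
  "CB v k lam (1 - (real_of_int d)^2 / (2 * real_of_int n * (real_of_int n + 1)))
              ((real_of_int n + 2) / (2 * (real_of_int d + real k))) \<le> real (size M)"
  (is "CB v k lam ?\<alpha> ?\<beta> \<le> _")
proof (rule size_ge_CB)
  define N where "N = real_of_int n + 1"
  have d: "0 \<le> real_of_int d" "real_of_int d \<le> real_of_int n - 1"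
    using d0 dn by linarith+
  have N: "N \<ge> 1" "N \<noteq> 0" using n_pos by (auto simp: N_def)
  have s: "q / (2 * N) * real_of_int d = (real_of_int d)\<^sup>2 / (2 * real_of_int n * (real_of_int n + 1))"
    by (simp add: q_def N_def power2_eq_square)
  have "?\<beta> \<le> caro_tuza N (q * to_V0 u + to_V1 u)" if u: "u \<in> V1" for u
  proof -
    have "q * to_V0 u \<le> to_V0 u"
      using q_less_1 V1_degrees(1)[OF u] by (simp add: mult_left_le_one_le q_nonneg)
    then have "(N + 1) / (2 * ((real_of_int d + real k - 1) + 1))
        \<le> caro_tuza N (q * to_V0 u + to_V1 u)"
      using V1_degrees[OF u] N k_ge d q_nonneg
      by (intro caro_tuza_ge_at add_nonneg_nonneg mult_nonneg_nonneg) (auto simp: N_def)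
    then show ?thesis by (simp add: N_def add.commute)
  qed
  then have "(\<Sum>u\<in>V1. ?\<beta>) \<le> (\<Sum>u\<in>V1. caro_tuza N (q * to_V0 u + to_V1 u))"
    by (rule sum_mono)
  moreover have "(\<Sum>u\<in>V1. q * to_V0 u / (2 * N)) \<le> (1 - ?\<alpha>) * real (card V0)"
  proof -
    have "(\<Sum>u\<in>V1. q * to_V0 u / (2 * N)) = q / (2 * N) * (\<Sum>u\<in>V1. to_V0 u)"
      by (simp add: sum_distrib_left)
    also have "\<dots> \<le> q / (2 * N) * (real_of_int d * real (card V0))"
      using sum_to_V0_le q_nonneg N by (intro mult_left_mono) auto
    also have "\<dots> = q / (2 * N) * real_of_int d * real (card V0)" by simp
    also have "\<dots> = (1 - ?\<alpha>) * real (card V0)" unfolding s by simp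
    finally show ?thesis .
  qed
  moreover have "(\<Sum>u\<in>V1. ?\<beta>) = ?\<beta> * real (card V1)" by simp
  moreover have "?\<alpha> * real (card V0) = real (card V0) - (1 - ?\<alpha>) * real (card V0)"
    by (simp only: left_diff_distrib)
  moreover have "real (card V0) + ((\<Sum>u\<in>V1. caro_tuza N (q * to_V0 u + to_V1 u))
      - (\<Sum>u\<in>V1. q * to_V0 u / (2 * N))) \<le> real (size M)"
    using size_ge_caro_tuza by (simp only: sum_subtractf N_def)
  ultimately show "?\<alpha> * real (card V0) + ?\<beta> * real (card V1) \<le> real (size M)"
    by argo
  \<comment> \<open>For \<open>2 * \<beta> \<le> \<alpha>\<close>: since
    \<open>k \<ge> n + 2\<close>, \<open>2 * \<beta>\<close> is at most
    \<open>1 - d / (d + n + 2)\<close>, and \<open>d \<le> n - 1\<close> gives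
    \<open>d * (d + n + 2) \<le> 2 * n * (n + 1)\<close>.\<close>
  have "real_of_int d * (real_of_int d + real_of_int n + 2)
      \<le> (real_of_int n - 1) * (real_of_int n - 1 + real_of_int n + 2)"
    using d by (intro mult_mono) auto
  also have "\<dots> \<le> 2 * real_of_int n * (real_of_int n + 1)"
    using n_pos by (simp add: algebra_simps)
  finally have "real_of_int d * (real_of_int d * (real_of_int d + real_of_int n + 2))
      \<le> real_of_int d * (2 * real_of_int n * (real_of_int n + 1))"
    using d by (intro mult_left_mono) auto
  then have "(real_of_int d)\<^sup>2 * (real_of_int d + real_of_int n + 2)
      \<le> real_of_int d * (2 * real_of_int n * (real_of_int n + 1))"
    by (simp add: power2_eq_square mult.assoc)
  then have "(real_of_int d)\<^sup>2 / (2 * real_of_int n * (real_of_int n + 1))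
      \<le> real_of_int d / (real_of_int d + real_of_int n + 2)"
    using d n_pos by (subst frac_le_eq) (auto intro!: divide_nonpos_nonneg)
  moreover have "real_of_int d / (real_of_int d + real_of_int n + 2)
      = 1 - (real_of_int n + 2) / (real_of_int d + real_of_int n + 2)"
    using d by (simp add: field_simps)
  moreover have "(real_of_int n + 2) / (real_of_int d + real k)
      \<le> (real_of_int n + 2) / (real_of_int d + real_of_int n + 2)"
    using d k_ge by (intro divide_left_mono mult_pos_pos) auto
  moreover have "2 * ?\<beta> = (real_of_int n + 2) / (real_of_int d + real k)"
  proof -
    have "2 * (a / (2 * b)) = a / b" for a b :: real by simp
    then show ?thesis .
  qed
  ultimately show "2 * ?\<beta> \<le> ?\<alpha>" by argo
  moreover have "?\<beta> \<ge> 0" using d by simp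
  ultimately show "?\<alpha> \<ge> 0" by linarith
qed

text \<open>The linear bound less the penalty is
  \<open>1 - (2 * q * to_V0 u + to_V1 u) / (2 * N)\<close>. As \<open>2 * q \<ge> 1\<close>, the
  worst case sends the whole excess degree \<open>d + k - 1\<close> to \<open>V0\<close>.\<close>

lemma bound_b:
  assumes "real_of_int d \<ge> real_of_int n / 2"
  shows "CB v k lam 1 (1 - real_of_int d * (real_of_int d + real k - 1)
                     / (real_of_int n * (real_of_int n + 1))) \<le> real (size M)"
  (is "CB v k lam 1 ?\<beta> \<le> _")
proof (rule size_ge_CB_1)
  define N where "N = real_of_int n + 1"
  have N: "N \<ge> 1" using n_pos by (simp add: N_def)
  have q2: "2 * q \<ge> 1" using assms n_pos by (simp add: q_def field_simps)
  have \<beta>: "?\<beta> = 1 - 2 * q * (real_of_int d + real k - 1) / (2 * N)"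
    unfolding N_def[symmetric] by (simp add: q_def)
  fix u assume u: "u \<in> V1"
  have "2 * q * to_V0 u + to_V1 u \<le> 2 * q * (to_V0 u + to_V1 u)"
    using q2 V1_degrees(2)[OF u] mult_right_mono[of 1 "2 * q" "to_V1 u"]
    by (simp add: algebra_simps)
  also have "\<dots> \<le> 2 * q * (real_of_int d + real k - 1)"
    using q_nonneg V1_degrees(3)[OF u] by (intro mult_left_mono) auto
  finally have "?\<beta> \<le> 1 - (2 * q * to_V0 u + to_V1 u) / (2 * N)"
    unfolding \<beta> using N by (intro diff_left_mono divide_right_mono) auto
  also have "\<dots> = 1 - (q * to_V0 u + to_V1 u) / (2 * N) - q * to_V0 u / (2 * N)"
    by (simp add: add_divide_distrib)
  also have "1 - (q * to_V0 u + to_V1 u) / (2 * N) \<le> caro_tuza N (q * to_V0 u + to_V1 u)"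
    using N q_nonneg V1_degrees[OF u] by (intro caro_tuza_ge_linear) auto
  finally show "?\<beta> \<le> caro_tuza (real_of_int n + 1) (q * to_V0 u + to_V1 u)
      - q * to_V0 u / (2 * (real_of_int n + 1))" by (simp add: N_def)
next
  have "real_of_int n * (real_of_int n + 1)
      \<le> real_of_int n * (real_of_int n / 2 + real k - 1)"
    using n_pos k_ge by (intro mult_left_mono) auto
  also have "\<dots> = 2 * (real_of_int n / 2 * (real_of_int n / 2 + real k - 1))" by simp
  also have "\<dots> \<le> 2 * (real_of_int d * (real_of_int d + real k - 1))"
    using assms n_pos k_ge by (intro mult_left_mono mult_mono) auto
  finally have "1 \<le> 2 * (real_of_int d * (real_of_int d + real k - 1))
      / (real_of_int n * (real_of_int n + 1))"
    using n_pos by (simp add: pos_le_divide_eq)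
  then show "2 * ?\<beta> \<le> 1" by simp
qed

text \<open>For weighted degree \<open>x\<close>, the total degree \<open>D\<close> forces
  \<open>(1 - q) * to_V0 u \<le> D - x\<close>. With \<open>c\<close> chosen so that
  \<open>c * (1 - q) = q / (2 * N)\<close>, the penalty is at most \<open>c * (D - x)\<close>, and
  the weight plus \<open>c * (x + 1)\<close> is bounded below by the square root.\<close>

lemma bound_c:
  assumes "real_of_int d < real_of_int n / 2"
  shows "CB v k lam 1
    (sqrt (real_of_int d * (real_of_int n + 2)
             / ((real_of_int n + 1) * (real_of_int n - real_of_int d)))
     - real_of_int d * (real_of_int d + real k)
         / (2 * (real_of_int n + 1) * (real_of_int n - real_of_int d))) \<le> real (size M)"
  (is "CB v k lam 1 ?\<beta> \<le> _")
proof (rule size_ge_CB_1)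
  define N where "N = real_of_int n + 1"
  define D where "D = real_of_int d + real k - 1"
  define c where "c = real_of_int d / (2 * N * (real_of_int n - real_of_int d))"
  have d: "0 \<le> real_of_int d" "real_of_int d < real_of_int n" using d0 dn by auto
  have N: "N \<ge> 1" using n_pos by (simp add: N_def)
  have n2: "real_of_int n + 2 = N + 1" by (simp add: N_def)
  have ND: "N \<le> D" using d k_ge by (simp add: N_def D_def)
  have c0: "c \<ge> 0" using d N by (simp add: c_def)
  \<comment> \<open>Here \<open>d < n / 2\<close> enters: it gives
    \<open>d / (n - d) \<le> 1\<close>.\<close>
  have c1: "c \<le> 1 / (2 * N)"
  proof -
    have "real_of_int d / (real_of_int n - real_of_int d) \<le> 1"
      using assms d by simp
    then have "real_of_int d / (real_of_int n - real_of_int d) / (2 * N) \<le> 1 / (2 * N)"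
      using N by (intro divide_right_mono) auto
    then show ?thesis by (simp add: c_def mult.commute)
  qed
  have cq: "c * (1 - q) = q / (2 * N)"
  proof -
    have "real_of_int n \<noteq> 0" "real_of_int n - real_of_int d \<noteq> 0" "N \<noteq> 0"
      using d N n_pos by auto
    then show ?thesis by (simp add: c_def q_def divide_simps)
  qed
  have \<beta>: "?\<beta> = sqrt (2 * c * (N + 1)) - c * (D + 1)"
    unfolding n2 N_def[symmetric] by (simp add: c_def D_def)
  show "2 * ?\<beta> \<le> 1"
  proof -
    \<comment> \<open>AM-GM at \<open>y = D + 1\<close> produces the very linear term that
      \<open>\<beta>\<close> subtracts, leaving at most \<open>1 / 2\<close>.\<close>
    have "sqrt (2 * c * (N + 1)) \<le> (N + 1) / (2 * (D + 1)) + c * (D + 1)"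
      using N ND c0 by (intro sqrt_le_hyperbola_plus_linear) auto
    also have "(N + 1) / (2 * (D + 1)) \<le> 1 / 2" using N ND by (simp add: field_simps)
    finally show ?thesis unfolding \<beta> by simp
  qed
  fix u assume u: "u \<in> V1"
  define x where "x = q * to_V0 u + to_V1 u"
  have x0: "x \<ge> 0" using q_nonneg V1_degrees[OF u] by (simp add: x_def)
  have "(1 - q) * to_V0 u \<le> D - x"
    using V1_degrees(3)[OF u] by (simp add: x_def D_def algebra_simps)
  then have "c * ((1 - q) * to_V0 u) \<le> c * (D - x)" using c0 by (rule mult_left_mono)
  then have "q * to_V0 u / (2 * N) \<le> c * (D - x)"
    by (simp add: cq flip: mult.assoc)
  then have "?\<beta> \<le> caro_tuza N x - q * to_V0 u / (2 * N)"
    unfolding \<beta> using caro_tuza_ge_sqrt[OF N c0 c1 x0] by (simp add: algebra_simps)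
  then show "?\<beta> \<le> caro_tuza (real_of_int n + 1) (q * to_V0 u + to_V1 u)
      - q * to_V0 u / (2 * (real_of_int n + 1))" by (simp add: N_def x_def)
qed

end

section \<open>Existence of minimum coverings and conclusion\<close>

lemma covering_exists:
  assumes "2 \<le> k" "k \<le> v"
  shows "\<exists>\<B>. covering v k lam {..<v} \<B>"
proof -
  define K where "K = {B. B \<subseteq> {..<v} \<and> card B = k}"
  have finK: "finite K" unfolding K_def by (rule finite_subset[of _ "Pow {..<v}"]) auto
  define \<B> where "\<B> = repeat_mset lam (mset_set K)"
  have count: "count \<B> B = (if B \<in> K then lam else 0)" for B
    using finK by (simp add: \<B>_def)
  then have set: "B \<in># \<B> \<Longrightarrow> B \<in> K" for B
    by (metis count_eq_zero_iff)
  have "lam \<le> size {#B \<in># \<B>. x \<in> B \<and> y \<in> B#}" if xy: "x < v" "y < v" "x \<noteq> y" for x y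
  proof -
    have "card {x, y} \<le> k" using xy assms by simp
    then obtain B where B: "B \<in> K" "x \<in> B" "y \<in> B"
      using exists_subset_between[of "{x, y}" k "{..<v}"] xy assms by (auto simp: K_def)
    \<comment> \<open>One \<open>k\<close>-subset through \<open>x\<close> and \<open>y\<close>
      already occurs \<open>lam\<close> times.\<close>
    have "lam = count {#B \<in># \<B>. x \<in> B \<and> y \<in> B#} B"
      using B by (simp add: count)
    also have "\<dots> \<le> size {#B \<in># \<B>. x \<in> B \<and> y \<in> B#}" by (rule count_le_size)
    finally show ?thesis .
  qed
  then have "covering v k lam {..<v} \<B>"
    using set by (auto simp: covering_def K_def)
  then show ?thesis by blast
qed

lemma covering_number_attained:
  assumes "2 \<le> k" "k \<le> v"
  shows "\<exists>(V :: nat set) \<B>. covering v k lam V \<B> \<and> size \<B> = covering_number lam v k"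
  unfolding covering_number_def
  by (rule LeastI_ex) (use covering_exists[OF assms, of lam] in blast)

theorem theorem6p2:
  fixes v k lam :: nat and r d n :: int
  assumes "lam > 0" and "3 \<le> k" and "k < v"
    and "int lam * (int v - 1) = r * (int k - 1) - d"
    and "0 \<le> d" and "d < int k - 1"
    and "n = r - int lam"
    and "r < int k"
    and "d < n"
  shows "int (covering_number lam v k) \<ge>
           \<lceil>CB v k lam
              (1 - (real_of_int d)^2 / (2 * real_of_int n * (real_of_int n + 1)))
              ((real_of_int n + 2) / (2 * (real_of_int d + real k)))\<rceil>
       \<and> (real_of_int d \<ge> real_of_int n / 2 \<and> d * (d + int k - 1) < n * (n + 1) \<longrightarrow>
          int (covering_number lam v k) \<ge>
           \<lceil>CB v k lam 1
              (1 - real_of_int d * (real_of_int d + real k - 1)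
                     / (real_of_int n * (real_of_int n + 1)))\<rceil>)
       \<and> (real_of_int d < real_of_int n / 2 \<and>
          4 * (n + 1) * (n + 2) * (n - d) > d * (d + int k)^2 \<longrightarrow>
          int (covering_number lam v k) \<ge>
           \<lceil>CB v k lam 1
              (sqrt (real_of_int d * (real_of_int n + 2)
                       / ((real_of_int n + 1) * (real_of_int n - real_of_int d)))
               - real_of_int d * (real_of_int d + real k)
                   / (2 * (real_of_int n + 1) * (real_of_int n - real_of_int d)))\<rceil>)"
proof -
  have "2 \<le> k" "k \<le> v" using assms(2,3) by auto
  from covering_number_attained[OF this] obtain V :: "nat set" and \<B>
    where "covering v k lam V \<B>" and size: "size \<B> = covering_number lam v k" by blast
  then interpret small_covering v k lam V \<B> r d n
    using assms by unfold_locales auto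
  have ceil: "\<lceil>x\<rceil> \<le> int (covering_number lam v k)" if "x \<le> real (size \<B>)" for x
    using that size by (simp add: ceiling_le_iff)
  show ?thesis
    using ceil[OF bound_a] ceil[OF bound_b] ceil[OF bound_c] by blast
qed

end
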